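(* Let $\ell>0$ and $b\neq0$ be integers with $\ell^2+4b\geq0$, and let $\mathbf{s}$ be defined by $s_0=0$, $s_1=1$, $s_n=\ell s_{n-1}+bs_{n-2}$ for $n\geq2$. Then the $h^*$-vector of $\mathcal{R}_n^{(\mathbf{s})}$ is symmetric for all $n\geq0$ if and only if $b=-1$. If $b\neq-1$, there is an integer $n_0=n_0(b,\ell)$ such that for all $n\geq n_0$ the $h^*$-vector of $\mathcal{R}_n^{(\mathbf{s})}$ is not symmetric.
   Context: Let $\mathcal{C}_n^{(\mathbf{s})}=\{\lambda\in\mathbb{R}^n: 0\leq\lambda_1/s_1\leq\cdots\leq\lambda_n/s_n\}$, $\mathcal{L}_n^{(\mathbf{s})}=\mathcal{C}_n^{(\mathbf{s})}\cap\mathbb{Z}^n$, and $\mathcal{R}_n^{(\mathbf{s})}=\{\lambda\in\mathcal{C}_n^{(\mathbf{s})}:\lambda_n\leq1\}$. For integers $t\geq0$ let $i(\mathcal{R}_n^{(\mathbf{s})},t)=|\{\lambda\in\mathcal{L}_n^{(\mathbf{s})}:\lambda_n\leq t\}|$ and $\mathcal{E}_n^{(\mathbf{s})}(x)=\sum_{t\geq0}i(\mathcal{R}_n^{(\mathbf{s})},t)x^t$. It is known that $Q_n^{(\mathbf{s})}(x):=(1-x^{s_n})^{n+1}\mathcal{E}_n^{(\mathbf{s})}(x)$ is a polynomial; its coefficient sequence is the $h^*$-vector of $\mathcal{R}_n^{(\mathbf{s})}$, which is called symmetric if it reads the same from left to right as from right to left. *)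

theory Defs
  imports Complex_Main "HOL-Computational_Algebra.Polynomial_FPS"
begin

text \<open>
  A vector of \<open>\<real>\<^sup>n\<close> is a function on \<open>nat\<close> that vanishes outside \<open>{1..n}\<close>,
  so that \<open>n\<close> can be quantified over.  For \<open>n = 0\<close> the last coordinate \<open>x n\<close> is thus \<open>0\<close>,
  and the cone is a single point.
\<close>

definition lecture_hall_cone :: "(nat \<Rightarrow> int) \<Rightarrow> nat \<Rightarrow> (nat \<Rightarrow> real) set" where
  "lecture_hall_cone s n =
    {x. (\<forall>i. i \<notin> {1..n} \<longrightarrow> x i = 0) \<and>
        (1 \<le> n \<longrightarrow> 0 \<le> x 1 / of_int (s 1)) \<and>
        (\<forall>i. 1 \<le> i \<and> i < n \<longrightarrow> x i / of_int (s i) \<le> x (i + 1) / of_int (s (i + 1)))}"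

definition lecture_hall_points :: "(nat \<Rightarrow> int) \<Rightarrow> nat \<Rightarrow> (nat \<Rightarrow> real) set" where
  "lecture_hall_points s n = {x \<in> lecture_hall_cone s n. \<forall>i. x i \<in> \<int>}"

definition lecture_hall_polytope :: "(nat \<Rightarrow> int) \<Rightarrow> nat \<Rightarrow> (nat \<Rightarrow> real) set" where
  "lecture_hall_polytope s n = {x \<in> lecture_hall_cone s n. x n \<le> 1}"

text \<open>
  The set below is finite when \<open>s\<close> is positive on \<open>{1..n}\<close>; only such sequences are intended here.
\<close>

definition ehrhart_count :: "(nat \<Rightarrow> int) \<Rightarrow> nat \<Rightarrow> nat \<Rightarrow> nat" where
  "ehrhart_count s n t = card {x \<in> lecture_hall_points s n. x n \<le> real t}"

lemma ehrhart_count_eq_dilate: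
  assumes "t > 0"
  shows "ehrhart_count s n t =
    card {x. (\<forall>i. x i \<in> \<int>) \<and> (\<exists>y \<in> lecture_hall_polytope s n. x = (\<lambda>i. real t * y i))}"
proof -
  have t: "real t > 0" using assms by simp
  have "(x \<in> lecture_hall_cone s n \<and> x n \<le> real t) \<longleftrightarrow>
      (\<exists>y \<in> lecture_hall_polytope s n. x = (\<lambda>i. real t * y i))" for x
  proof
    assume x: "x \<in> lecture_hall_cone s n \<and> x n \<le> real t"
    have swap: "u / real t / v = u / v / real t" for u v :: real by simp
    have "(\<lambda>i. x i / real t) \<in> lecture_hall_polytope s n"
      using x t unfolding lecture_hall_polytope_def lecture_hall_cone_def
      by (simp add: swap divide_right_mono del: divide_divide_eq_left)
    moreover have "x = (\<lambda>i. real t * (x i / real t))" using t by auto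
    ultimately show "\<exists>y \<in> lecture_hall_polytope s n. x = (\<lambda>i. real t * y i)"
      by (intro bexI[of _ "\<lambda>i. x i / real t"])
  next
    assume "\<exists>y \<in> lecture_hall_polytope s n. x = (\<lambda>i. real t * y i)"
    then obtain y where y: "y \<in> lecture_hall_polytope s n" "x = (\<lambda>i. real t * y i)" by blast
    show "x \<in> lecture_hall_cone s n \<and> x n \<le> real t"
      using y t
      by (auto simp: lecture_hall_polytope_def lecture_hall_cone_def simp flip: times_divide_eq_right)
  qed
  then have "{x \<in> lecture_hall_points s n. x n \<le> real t} =
      {x. (\<forall>i. x i \<in> \<int>) \<and> (\<exists>y \<in> lecture_hall_polytope s n. x = (\<lambda>i. real t * y i))}"
    by (intro set_eqI, unfold lecture_hall_points_def mem_Collect_eq) metis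
  then show ?thesis by (simp add: ehrhart_count_def)
qed

definition ehrhart_series :: "(nat \<Rightarrow> int) \<Rightarrow> nat \<Rightarrow> int fps" where
  "ehrhart_series s n = Abs_fps (\<lambda>t. int (ehrhart_count s n t))"

text \<open>
  \<open>nat\<close> would truncate a negative \<open>s n\<close>; \<open>s n\<close> is meant to be nonnegative.
\<close>

definition Q_series :: "(nat \<Rightarrow> int) \<Rightarrow> nat \<Rightarrow> int fps" where
  "Q_series s n = (1 - fps_X ^ nat (s n)) ^ (n + 1) * ehrhart_series s n"

text \<open>
  The series above is known to be a polynomial when \<open>s\<close> is positive on \<open>{1..n}\<close>;
  \<open>Q_poly\<close> is that polynomial.
\<close>

definition Q_poly :: "(nat \<Rightarrow> int) \<Rightarrow> nat \<Rightarrow> int poly" where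
  "Q_poly s n = (THE p. fps_of_poly p = Q_series s n)"

text \<open>
  The list runs from the constant to the leading coefficient, without trailing zeros.  For
  \<open>s 0 = 0\<close> and \<open>n = 0\<close> the factor \<open>1 - x\<^sup>0\<close> vanishes, and the list is empty.
\<close>

definition h_star_vector :: "(nat \<Rightarrow> int) \<Rightarrow> nat \<Rightarrow> int list" where
  "h_star_vector s n = coeffs (Q_poly s n)"

definition h_star_symmetric :: "(nat \<Rightarrow> int) \<Rightarrow> nat \<Rightarrow> bool" where
  "h_star_symmetric s n \<longleftrightarrow> rev (h_star_vector s n) = h_star_vector s n"

end

theory Submission
  imports Defs
begin

text \<open>
  Subtracting rays one at a time shows that \<open>(1 - x\<^bsup>s n\<^esup>)\<^sup>n\<close> times the series of the closed
  (resp. open) cone counts the lattice points of a half-open parallelepiped, and the point reflection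
  of the parallelepiped exchanges the two.  So the \<open>h\<^sup>*\<close>-vector is symmetric iff the series of the
  open cone is \<open>x\<^sup>k\<close> times that of the closed one, which, as the latter has constant term \<open>1\<close>, means
  that the interior lattice points are the translate of all lattice points by some \<open>c\<close>.

  Such a \<open>c\<close> lies at lattice distance \<open>1\<close> from every facet, that is,
  \<open>s\<^bsub>j-1\<^esub> c\<^sub>j - s\<^sub>j c\<^bsub>j-1\<^esub> = g\<^sub>j := gcd s\<^sub>j s\<^bsub>j-1\<^esub>\<close>.  The recurrence turns two consecutive
  equations into \<open>s\<^bsub>j-1\<^esub> dvd g\<^sub>j + b g\<^bsub>j-1\<^esub>\<close>.  By Cassini's identity
  \<open>g\<^sub>j g\<^bsub>j+1\<^esub>\<close> divides a power of \<open>b\<close>, so that \<open>g\<^sub>j\<close> is small against \<open>s\<^sub>j\<close>; hence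
  \<open>g\<^sub>j = -b g\<^bsub>j-1\<^esub>\<close> for all large \<open>j\<close>, and this growth contradicts the bound on \<open>g\<^sub>j\<close> unless \<open>b = -1\<close>.
  For \<open>b = -1\<close> the point \<open>c\<^sub>j = s\<^sub>j + s\<^bsub>j-1\<^esub>\<close> works.
\<close>

section \<open>Self-reciprocal polynomials\<close>

text \<open>The series \<open>q\<close> reverses \<open>p\<close> at the nominal degree
  \<open>N\<close>, \<open>reflect_poly\<close> at the true degree, so the two differ by a power of
  \<open>fps_X\<close>. In the converse, the nonzero constant term forces
  \<open>degree p = N - k\<close>.\<close>

lemma reflect_poly_fixed_iff:
  fixes p :: "'a :: comm_ring_1 poly"
  assumes p0: "coeff p 0 \<noteq> 0" and p: "\<And>i. N < i \<Longrightarrow> coeff p i = 0"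
    and q: "\<And>m. fps_nth q m = (if m \<le> N then coeff p (N - m) else 0)"
  shows "reflect_poly p = p \<longleftrightarrow> (\<exists>k. q = fps_X ^ k * fps_of_poly p)"
proof
  assume sym: "reflect_poly p = p"
  let ?D = "degree p"
  have D: "?D \<le> N" using p by (metis degree_le not_le)
  have "q = fps_X ^ (N - ?D) * fps_of_poly p"
  proof (rule fps_ext)
    fix m
    have "coeff p (m - (N - ?D)) = coeff p (N - m)" if "N - ?D \<le> m" "m \<le> N"
    proof -
      have "coeff p (m - (N - ?D)) = coeff (reflect_poly p) (m - (N - ?D))" using sym by simp
      also have "\<dots> = coeff p (?D - (m - (N - ?D)))"
        using that D by (subst coeff_reflect_poly) auto
      also have "?D - (m - (N - ?D)) = N - m" using that D by simp
      finally show ?thesis .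
    qed
    then show "fps_nth q m = fps_nth (fps_X ^ (N - ?D) * fps_of_poly p) m"
      using D by (auto simp: q fps_X_power_mult_nth coeff_eq_0)
  qed
  then show "\<exists>k. q = fps_X ^ k * fps_of_poly p" by blast
next
  assume "\<exists>k. q = fps_X ^ k * fps_of_poly p"
  then obtain k where k: "q = fps_X ^ k * fps_of_poly p" by blast
  have qk: "fps_nth q m = (if m < k then 0 else coeff p (m - k))" for m
    by (simp add: k fps_X_power_mult_nth)
  have "k \<le> N" using q[of k] qk[of k] p0 by (auto split: if_splits)
  have lead: "coeff p (N - k) \<noteq> 0" using q[of k] qk[of k] p0 by (auto split: if_splits)
  have above: "coeff p i = 0" if "N - k < i" for i
  proof (cases "i \<le> N")
    case True
    then have "N - i < k" using that by linarith
    then show ?thesis using q[of "N - i"] qk[of "N - i"] True by simp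
  qed (use p in simp)
  have deg: "degree p = N - k"
    using lead above by (metis degree_le le_degree le_antisym)
  have "coeff p (N - k - i) = coeff p i" if "i \<le> N - k" for i
    using q[of "i + k"] qk[of "i + k"] that \<open>k \<le> N\<close> by (simp add: add.commute)
  then show "reflect_poly p = p"
    by (intro poly_eqI) (auto simp: coeff_reflect_poly deg above)
qed

lemma fps_eventually_zero_poly:
  assumes "\<And>m. N < m \<Longrightarrow> fps_nth f m = 0"
  obtains p where "fps_of_poly p = f"
proof
  show "fps_of_poly (Poly (map (fps_nth f) [0..<Suc N])) = f"
    using assms by (intro fps_ext) (auto simp: nth_default_def simp del: upt_Suc)
qed

text \<open>The quotient of \<open>1 - x^d\<close> by \<open>1 - x\<close>. It enters because the
  Ehrhart count collects the points with \<open>x n \<le> t\<close>, while a level fixes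
  \<open>x n\<close>.\<close>

definition geometric_poly :: "nat \<Rightarrow> int poly" where
  "geometric_poly d = Poly (replicate d 1)"

lemma coeff_geometric_poly: "coeff (geometric_poly d) i = (if i < d then 1 else 0)"
  by (simp add: geometric_poly_def nth_default_def)

lemma degree_geometric_poly: "degree (geometric_poly d) = d - 1"
  by (cases d) (auto intro!: antisym degree_le le_degree simp: coeff_geometric_poly)

lemma reflect_geometric_poly: "reflect_poly (geometric_poly d) = geometric_poly d"
  by (intro poly_eqI) (auto simp: coeff_reflect_poly degree_geometric_poly coeff_geometric_poly)

lemma fps_of_geometric_poly: "(1 - fps_X) * fps_of_poly (geometric_poly d) = 1 - fps_X ^ d"
  by (intro fps_ext) (auto simp: left_diff_distrib coeff_geometric_poly fps_X_power_nth)

section \<open>Lattice points of lecture hall cones\<close>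

definition level :: "nat \<Rightarrow> (nat \<Rightarrow> real) set \<Rightarrow> nat \<Rightarrow> (nat \<Rightarrow> real) set" where
  "level n A m = {x \<in> A. x n = real m}"

definition level_series :: "nat \<Rightarrow> (nat \<Rightarrow> real) set \<Rightarrow> int fps" where
  "level_series n A = Abs_fps (\<lambda>m. int (card (level n A m)))"

definition integer_vectors :: "nat \<Rightarrow> (nat \<Rightarrow> real) set" where
  "integer_vectors n = {x. (\<forall>i. x i \<in> \<int>) \<and> (\<forall>i. i \<notin> {1..n} \<longrightarrow> x i = 0)}"

text \<open>
  The coordinates of \<open>x\<close> in the basis of the rays \<open>(0, \<dots>, 0, s\<^sub>i, \<dots>, s\<^sub>n)\<close> of the cone.
  For \<open>s 0 = 0\<close> the second quotient is \<open>0\<close> at \<open>i = 1\<close>, as it should be.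
\<close>

definition ray_coord :: "(nat \<Rightarrow> int) \<Rightarrow> (nat \<Rightarrow> real) \<Rightarrow> nat \<Rightarrow> real" where
  "ray_coord s x i = x i / of_int (s i) - x (i - 1) / of_int (s (i - 1))"

definition ray :: "(nat \<Rightarrow> int) \<Rightarrow> nat \<Rightarrow> nat \<Rightarrow> nat \<Rightarrow> real" where
  "ray s n i = (\<lambda>j. if i \<le> j \<and> j \<le> n then of_int (s j) else 0)"

text \<open>
  For \<open>L\<close> the predicate \<open>(\<le>) 0\<close> or \<open>(<) 0\<close>, this interpolates between the closed or open cone
  (\<open>k = 0\<close>) and its half-open fundamental parallelepiped (\<open>k = n\<close>).
\<close>

definition wedge :: "(nat \<Rightarrow> int) \<Rightarrow> nat \<Rightarrow> (real \<Rightarrow> bool) \<Rightarrow> nat \<Rightarrow> (nat \<Rightarrow> real) set" where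
  "wedge s n L k = {x \<in> integer_vectors n.
     (\<forall>i\<in>{1..n}. L (ray_coord s x i)) \<and> (\<forall>i\<in>{1..k}. \<not> L (ray_coord s x i - 1))}"

lemma ray_coord_add: "ray_coord s (\<lambda>j. x j + y j) i = ray_coord s x i + ray_coord s y i"
  by (simp add: ray_coord_def add_divide_distrib)

lemma ray_coord_diff: "ray_coord s (\<lambda>j. x j - y j) i = ray_coord s x i - ray_coord s y i"
  by (simp add: ray_coord_def diff_divide_distrib)

lemma ray_coord_mult: "ray_coord s (\<lambda>j. a * x j) i = a * ray_coord s x i"
  by (simp add: ray_coord_def algebra_simps)

lemma integer_vectors_add:
  "x \<in> integer_vectors n \<Longrightarrow> y \<in> integer_vectors n \<Longrightarrow> (\<lambda>j. x j + y j) \<in> integer_vectors n"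
  by (auto simp: integer_vectors_def)

lemma integer_vectors_diff:
  "x \<in> integer_vectors n \<Longrightarrow> y \<in> integer_vectors n \<Longrightarrow> (\<lambda>j. x j - y j) \<in> integer_vectors n"
  by (auto simp: integer_vectors_def)

lemma ray_integer: "1 \<le> i \<Longrightarrow> ray s n i \<in> integer_vectors n"
  by (auto simp: integer_vectors_def ray_def)

text \<open>Translation by \<open>v\<close> embeds level \<open>m - d\<close> into level
  \<open>m\<close>, so multiplying by \<open>1 - fps_X ^ d\<close> removes the translated copy of
  \<open>A\<close>. Nonnegative heights keep the levels below \<open>d\<close> free of
  translates.\<close>

lemma level_series_translate:
  assumes fin: "\<And>m. finite (level n A m)"
    and nonneg: "\<And>x. x \<in> A \<Longrightarrow> 0 \<le> x n"
    and v: "v n = real d"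
    and closed: "\<And>x. x \<in> A \<Longrightarrow> (\<lambda>j. x j + v j) \<in> A"
  shows "(1 - fps_X ^ d) * level_series n A = level_series n (A - (\<lambda>x j. x j + v j) ` A)"
proof -
  let ?T = "\<lambda>x j. x j + v j"
  have inj: "inj_on ?T B" for B
    by (rule inj_onI) (auto simp: fun_eq_iff)
  have T: "level n (?T ` A) m = (if m < d then {} else ?T ` level n A (m - d))" for m
  proof (cases "m < d")
    case True
    have "?T x n > real m" if "x \<in> A" for x
      using nonneg[OF that] v True by simp
    then show ?thesis using True by (force simp: level_def)
  next
    case False
    then show ?thesis using v by (auto simp: level_def of_nat_diff)
  qed
  show ?thesis
  proof (rule fps_ext)
    fix m
    have sub: "level n (?T ` A) m \<subseteq> level n A m"
      using closed by (auto simp: level_def)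
    have "fps_nth ((1 - fps_X ^ d) * level_series n A) m =
        int (card (level n A m)) - int (if m < d then 0 else card (level n A (m - d)))"
      by (simp add: left_diff_distrib fps_X_power_mult_nth level_series_def)
    also have "(if m < d then 0 else card (level n A (m - d))) = card (level n (?T ` A) m)"
      unfolding T by (simp add: card_image[OF inj])
    also have "int (card (level n A m)) - int \<dots> = int (card (level n A m - level n (?T ` A) m))"
      using sub fin[of m] by (simp add: card_Diff_subset finite_subset card_mono of_nat_diff)
    also have "level n A m - level n (?T ` A) m = level n (A - ?T ` A) m"
      by (auto simp: level_def)
    finally show "fps_nth ((1 - fps_X ^ d) * level_series n A) m =
        fps_nth (level_series n (A - ?T ` A)) m"
      by (simp add: level_series_def)
  qed
qed

section \<open>From the cone to its half-open parallelepiped\<close>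

locale lecture_hall =
  fixes s :: "nat \<Rightarrow> int" and n :: nat
  assumes s_0: "s 0 = 0"
    and s_pos: "\<And>i. 1 \<le> i \<Longrightarrow> i \<le> n \<Longrightarrow> 0 < s i"
    and n_pos: "1 \<le> n"
begin

lemma s_n_pos: "0 < s n"
  using s_pos n_pos by simp

lemma ray_coord_ray:
  assumes "i \<in> {1..n}" "j \<in> {1..n}"
  shows "ray_coord s (ray s n i) j = (if i = j then 1 else 0)"
proof -
  have "s j \<noteq> 0" "j > 1 \<Longrightarrow> s (j - 1) \<noteq> 0"
    using s_pos[of j] s_pos[of "j - 1"] assms by force+
  then show ?thesis
    using assms s_0 by (auto simp: ray_coord_def ray_def)
qed

lemma sum_ray_coord: "(\<Sum>i=1..j. ray_coord s x i) = x j / of_int (s j)"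
proof (induction j)
  case 0
  then show ?case by (simp add: s_0)
next
  case (Suc j)
  then show ?case by (simp add: ray_coord_def)
qed

text \<open>Partial sums of nonnegative ray coordinates increase, so \<open>x j / s j\<close> is at
  most \<open>x n / s n\<close>, hence at most \<open>x n\<close>, as \<open>s n\<close> is a
  positive integer. Each level thus lies in a finite box.\<close>

lemma coord_bounds:
  assumes "\<And>i. i \<in> {1..n} \<Longrightarrow> 0 \<le> ray_coord s x i" and "x \<in> integer_vectors n" and "j \<le> n"
  shows "0 \<le> x j" "x j \<le> of_int (s j) * x n"
proof -
  have "x 0 = 0" using assms by (auto simp: integer_vectors_def)
  have le: "x j / of_int (s j) \<le> x n / of_int (s n)"
    using assms unfolding sum_ray_coord[symmetric] by (intro sum_mono2) auto
  have nn: "0 \<le> x i / of_int (s i)" if "i \<le> n" for i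
    using assms that unfolding sum_ray_coord[symmetric] by (intro sum_nonneg) auto
  have "0 \<le> x i" if "i \<le> n" for i
    using nn[OF that] s_pos[of i] that \<open>x 0 = 0\<close> by (cases "i = 0") (auto simp: zero_le_divide_iff)
  note x = this
  show "0 \<le> x j" using x assms by blast
  have "x n / of_int (s n) \<le> x n"
    using s_n_pos x[of n] by (simp add: divide_le_eq mult_le_cancel_left1)
  with le have "x j / of_int (s j) \<le> x n" by simp
  then show "x j \<le> of_int (s j) * x n"
    using s_pos[of j] \<open>j \<le> n\<close> \<open>x 0 = 0\<close> s_0 by (cases "j = 0") (auto simp: divide_le_eq mult.commute)
qed

lemma finite_wedge_le:
  assumes "\<And>m. L m \<Longrightarrow> 0 \<le> m"
  shows "finite {x \<in> wedge s n L k. x n \<le> real t}"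
proof -
  let ?B = "(\<lambda>z. real_of_int z) ` (\<Union>j\<in>{1..n}. {0..s j * int t})"
  have "x j \<in> ?B" if "x \<in> wedge s n L k" "x n \<le> real t" "j \<in> {1..n}" for x j
  proof -
    have x: "x \<in> integer_vectors n" "\<And>i. i \<in> {1..n} \<Longrightarrow> 0 \<le> ray_coord s x i"
      using that assms by (auto simp: wedge_def)
    then have "x j \<in> \<int>" by (simp add: integer_vectors_def)
    then obtain z where z: "x j = of_int z" by (rule Ints_cases)
    have "x j \<le> of_int (s j) * x n" "0 \<le> x j"
      using coord_bounds[of x j] x that by auto
    moreover have "of_int (s j) * x n \<le> of_int (s j) * real t"
      using that s_pos[of j] by (intro mult_left_mono) auto
    ultimately have "of_int z \<le> real_of_int (s j * int t)" "0 \<le> z" using z by auto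
    then have "z \<in> {0..s j * int t}" by (metis atLeastAtMost_iff of_int_le_iff)
    then show ?thesis using z that(3) by blast
  qed
  then have "{x \<in> wedge s n L k. x n \<le> real t} \<subseteq>
      {x. \<forall>j. (j \<in> {1..n} \<longrightarrow> x j \<in> ?B) \<and> (j \<notin> {1..n} \<longrightarrow> x j = 0)}"
    by (auto simp: wedge_def integer_vectors_def)
  then show ?thesis
    by (rule finite_subset) (intro finite_set_of_finite_funs finite_imageI, auto)
qed

lemma finite_level_wedge:
  assumes "\<And>m. L m \<Longrightarrow> 0 \<le> m"
  shows "finite (level n (wedge s n L k) t)"
  by (rule finite_subset[OF _ finite_wedge_le[of L k t]]) (use assms in \<open>auto simp: level_def\<close>)

lemma wedge_nonneg:
  assumes "\<And>m. L m \<Longrightarrow> 0 \<le> m" "x \<in> wedge s n L k"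
  shows "0 \<le> x n"
  using coord_bounds[of x n] assms by (auto simp: wedge_def)

text \<open>Adding ray \<open>k + 1\<close> raises ray coordinate \<open>k + 1\<close> by 1 and
  fixes the others. The translates are thus the points that still satisfy \<open>L\<close> after
  lowering this coordinate; removing them adds one upper bound.\<close>

lemma wedge_Suc:
  assumes "\<And>m. L m \<Longrightarrow> L (m + 1)" and "k < n"
  shows "wedge s n L k - (\<lambda>x j. x j + ray s n (Suc k) j) ` wedge s n L k = wedge s n L (Suc k)"
    and "x \<in> wedge s n L k \<Longrightarrow> (\<lambda>j. x j + ray s n (Suc k) j) \<in> wedge s n L k"
proof -
  let ?v = "ray s n (Suc k)"
  have v: "?v \<in> integer_vectors n" by (simp add: ray_integer)
  have vc: "ray_coord s ?v j = (if j = Suc k then 1 else 0)" if "j \<in> {1..n}" for j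
    using ray_coord_ray[of "Suc k" j] that assms(2) by auto
  show "(\<lambda>j. x j + ?v j) \<in> wedge s n L k" if "x \<in> wedge s n L k" for x
    using that v assms by (auto simp: wedge_def integer_vectors_add ray_coord_add vc)
  have "x \<in> (\<lambda>x j. x j + ?v j) ` wedge s n L k \<longleftrightarrow> L (ray_coord s x (Suc k) - 1)"
    if x: "x \<in> wedge s n L k" for x
  proof
    assume "x \<in> (\<lambda>x j. x j + ?v j) ` wedge s n L k"
    then obtain y where "y \<in> wedge s n L k" "x = (\<lambda>j. y j + ?v j)" by blast
    then show "L (ray_coord s x (Suc k) - 1)"
      using assms(2) by (auto simp: wedge_def ray_coord_add vc)
  next
    assume "L (ray_coord s x (Suc k) - 1)"
    then have "(\<lambda>j. x j - ?v j) \<in> wedge s n L k"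
      using x v assms by (auto simp: wedge_def integer_vectors_diff ray_coord_diff vc)
    then show "x \<in> (\<lambda>x j. x j + ?v j) ` wedge s n L k" by (rule rev_image_eqI) simp
  qed
  then have "wedge s n L k - (\<lambda>x j. x j + ?v j) ` wedge s n L k =
      {x \<in> wedge s n L k. \<not> L (ray_coord s x (Suc k) - 1)}" by blast
  also have "\<dots> = wedge s n L (Suc k)"
    by (auto simp: wedge_def atLeastAtMostSuc_conv)
  finally show "wedge s n L k - (\<lambda>x j. x j + ?v j) ` wedge s n L k = wedge s n L (Suc k)" .
qed

text \<open>Every ray ends at height \<open>s n\<close>, so each removal contributes the same
  factor.\<close>

lemma level_series_wedge:
  assumes L: "\<And>m. L m \<Longrightarrow> 0 \<le> m" "\<And>m. L m \<Longrightarrow> L (m + 1)" and "k \<le> n"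
  shows "(1 - fps_X ^ nat (s n)) ^ k * level_series n (wedge s n L 0) = level_series n (wedge s n L k)"
  using \<open>k \<le> n\<close>
proof (induction k)
  case 0
  then show ?case by simp
next
  case (Suc k)
  then have "(1 - fps_X ^ nat (s n)) * level_series n (wedge s n L k) =
      level_series n (wedge s n L k - (\<lambda>x j. x j + ray s n (Suc k) j) ` wedge s n L k)"
    using s_n_pos finite_level_wedge[where L = L, OF L(1)] wedge_nonneg[where L = L, OF L(1)]
      wedge_Suc(2)[where L = L, OF L(2)]
    by (intro level_series_translate) (auto simp: ray_def)
  moreover have "\<dots> = level_series n (wedge s n L (Suc k))"
    using wedge_Suc(1)[where L = L, OF L(2)] Suc.prems by simp
  ultimately show ?case
    using Suc by (simp add: mult.assoc)
qed

text \<open>Subtraction from \<open>e\<close> turns a ray coordinate \<open>t\<close> into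
  \<open>1 - t\<close>, which exchanges \<open>0 < t \<le> 1\<close> with
  \<open>0 \<le> t < 1\<close>.\<close>

lemma parallelepiped_reflect:
  assumes "m \<le> n * nat (s n)"
  shows "card (level n (wedge s n ((<) 0) n) m) = card (level n (wedge s n ((\<le>) 0) n) (n * nat (s n) - m))"
proof -
  \<comment> \<open>The sum of all rays: coordinate \<open>j\<close> receives \<open>s j\<close>
    from each of the rays 1 to \<open>j\<close>.\<close>
  define e where "e = (\<lambda>j. if j \<le> n then real j * of_int (s j) else 0)"
  have e: "e \<in> integer_vectors n" by (auto simp: e_def integer_vectors_def)
  have ec: "ray_coord s e i = 1" if "i \<in> {1..n}" for i
  proof -
    have "s i \<noteq> 0" "i > 1 \<Longrightarrow> s (i - 1) \<noteq> 0"
      using s_pos[of i] s_pos[of "i - 1"] that by force+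
    then show ?thesis using that s_0
      by (cases "i = 1") (auto simp: ray_coord_def e_def of_nat_diff)
  qed
  have en: "e n = real (n * nat (s n))" using s_n_pos by (simp add: e_def)
  let ?f = "\<lambda>x j. e j - x j"
  have "bij_betw ?f (level n (wedge s n ((<) 0) n) m)
      (level n (wedge s n ((\<le>) 0) n) (n * nat (s n) - m))"
    by (rule bij_betw_byWitness[where f' = ?f])
       (use assms en in \<open>auto simp: level_def wedge_def integer_vectors_diff[OF e] ray_coord_diff ec
          of_nat_diff simp del: of_nat_mult\<close>)
  then show ?thesis by (rule bij_betw_same_card)
qed

lemma parallelepiped_empty:
  assumes "n * nat (s n) < m" and "L = (<) 0 \<or> L = (\<le>) 0"
  shows "level n (wedge s n L n) m = {}"
proof -
  have "x n \<le> real (n * nat (s n))" if "x \<in> wedge s n L n" for x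
  proof -
    have "x n / of_int (s n) \<le> (\<Sum>i=1..n. 1)"
      unfolding sum_ray_coord[symmetric]
      by (intro sum_mono) (use that assms in \<open>auto simp: wedge_def not_le not_less intro: less_imp_le\<close>)
    then show ?thesis using s_n_pos by (simp add: divide_le_eq)
  qed
  then have "x n \<noteq> real m" if "x \<in> wedge s n L n" for x
    using that assms(1) by (metis not_le of_nat_less_iff)
  then show ?thesis by (auto simp: level_def)
qed

section \<open>Symmetry as a property of the cone\<close>

lemma closed_wedge_eq: "wedge s n ((\<le>) 0) 0 = lecture_hall_points s n"
proof -
  have "(\<forall>i\<in>{1..n}. 0 \<le> ray_coord s x i) \<longleftrightarrow> (1 \<le> n \<longrightarrow> 0 \<le> x 1 / of_int (s 1)) \<and>
        (\<forall>i. 1 \<le> i \<and> i < n \<longrightarrow> x i / of_int (s i) \<le> x (i + 1) / of_int (s (i + 1)))" for x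
  proof -
    have "(\<forall>i\<in>{1..n}. 0 \<le> ray_coord s x i) \<longleftrightarrow> (\<forall>i<n. 0 \<le> ray_coord s x (Suc i))"
      by (auto simp: Ball_def) (metis Suc_le_D Suc_le_eq One_nat_def)
    also have "\<dots> \<longleftrightarrow> 0 \<le> ray_coord s x 1 \<and> (\<forall>i. 1 \<le> i \<and> i < n \<longrightarrow> 0 \<le> ray_coord s x (Suc i))"
      using n_pos by (metis One_nat_def Suc_le_eq not_less_eq_eq less_one linorder_not_less)
    finally show ?thesis using n_pos by (simp add: ray_coord_def s_0)
  qed
  then show ?thesis
    by (auto simp: wedge_def lecture_hall_points_def lecture_hall_cone_def integer_vectors_def)
qed

lemma level_0_closed_wedge: "level n (wedge s n ((\<le>) 0) k) 0 = {\<lambda>_. 0}"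
proof -
  have "x = (\<lambda>_. 0)" if x: "x \<in> level n (wedge s n ((\<le>) 0) k) 0" for x
  proof
    fix j
    have "x \<in> wedge s n ((\<le>) 0) k" "x n = 0" using x by (auto simp: level_def)
    then show "x j = 0"
      using coord_bounds[of x j] by (cases "j \<le> n") (auto simp: wedge_def integer_vectors_def)
  qed
  moreover have "(\<lambda>_. 0) \<in> level n (wedge s n ((\<le>) 0) k) 0"
    by (auto simp: level_def wedge_def integer_vectors_def ray_coord_def)
  ultimately show ?thesis by blast
qed

text \<open>Multiplication by \<open>1 - fps_X\<close> takes differences of consecutive counts, and
  integrality of \<open>x n\<close> leaves exactly one level.\<close>

lemma ehrhart_series_eq:
  "(1 - fps_X) * ehrhart_series s n = level_series n (wedge s n ((\<le>) 0) 0)"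
proof (rule fps_ext)
  fix t
  let ?W = "wedge s n ((\<le>) 0) 0"
  have fin: "finite {x \<in> ?W. x n \<le> real t}" for t
    by (rule finite_wedge_le) simp
  have fin': "finite (level n ?W t)" for t
    by (rule finite_level_wedge) simp
  have nonneg: "0 \<le> x n" if "x \<in> ?W" for x
    by (rule wedge_nonneg[OF _ that]) simp
  show "fps_nth ((1 - fps_X) * ehrhart_series s n) t = fps_nth (level_series n ?W) t"
  proof (cases t)
    case 0
    have "{x \<in> ?W. x n \<le> 0} = level n ?W 0"
      using nonneg by (force simp: level_def)
    then show ?thesis using 0
      by (simp add: left_diff_distrib ehrhart_series_def ehrhart_count_def level_series_def
          flip: closed_wedge_eq)
  next
    case (Suc u)
    have "x n \<le> real u \<or> x n = real (Suc u)" if "x \<in> ?W" "x n \<le> real (Suc u)" for x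
    proof -
      have "x n \<in> \<int>" using that by (simp add: wedge_def integer_vectors_def)
      then obtain z where z: "x n = of_int z" by (rule Ints_cases)
      with that have "z \<le> int (Suc u)"
        by (metis of_int_le_iff of_int_of_nat_eq)
      then have "z \<le> int u \<or> z = int (Suc u)" by linarith
      then show ?thesis using z by auto
    qed
    then have "{x \<in> ?W. x n \<le> real (Suc u)} = {x \<in> ?W. x n \<le> real u} \<union> level n ?W (Suc u)"
      by (force simp: level_def)
    then have "card {x \<in> ?W. x n \<le> real (Suc u)} =
        card {x \<in> ?W. x n \<le> real u} + card (level n ?W (Suc u))"
      by (simp only:) (rule card_Un_disjoint[OF fin fin'], auto simp: level_def)
    then show ?thesis using Suc
      by (simp add: left_diff_distrib ehrhart_series_def ehrhart_count_def level_series_def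
          flip: closed_wedge_eq)
  qed
qed

lemma h_star_symmetric_iff_reciprocal:
  "h_star_symmetric s n \<longleftrightarrow>
    (\<exists>k. level_series n (wedge s n ((<) 0) 0) = fps_X ^ k * level_series n (wedge s n ((\<le>) 0) 0))"
proof -
  let ?d = "nat (s n)"
  let ?F = "level_series n (wedge s n ((\<le>) 0) 0)" and ?F' = "level_series n (wedge s n ((<) 0) 0)"
  let ?P = "level_series n (wedge s n ((\<le>) 0) n)" and ?P' = "level_series n (wedge s n ((<) 0) n)"
  have P: "?P = (1 - fps_X ^ ?d) ^ n * ?F"
    by (rule level_series_wedge[symmetric]) auto
  have P': "?P' = (1 - fps_X ^ ?d) ^ n * ?F'"
    by (rule level_series_wedge[symmetric]) auto
  have "fps_nth ?P m = 0" if "n * ?d < m" for m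
    using parallelepiped_empty[of m "(\<le>) 0"] that by (simp add: level_series_def)
  then obtain p where p: "fps_of_poly p = ?P" by (rule fps_eventually_zero_poly)
  then have coeff_p: "coeff p m = int (card (level n (wedge s n ((\<le>) 0) n) m))" for m
    by (metis fps_of_poly_nth fps_nth_Abs_fps level_series_def)
  have p0: "coeff p 0 = 1" by (simp add: coeff_p level_0_closed_wedge)
  \<comment> \<open>Of the \<open>n + 1\<close> factors, \<open>n\<close> cut the cone down to the
    parallelepiped; the last one, divided by \<open>1 - fps_X\<close>, is the palindromic
    \<open>geometric_poly\<close>, which cancels below.\<close>
  have "(1 - fps_X) * Q_series s n = (1 - fps_X ^ ?d) ^ (n + 1) * ((1 - fps_X) * ehrhart_series s n)"
    by (simp add: Q_series_def algebra_simps)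
  also have "\<dots> = (1 - fps_X ^ ?d) * fps_of_poly p"
    by (simp add: ehrhart_series_eq p P mult.assoc)
  also have "\<dots> = (1 - fps_X) * fps_of_poly (geometric_poly ?d * p)"
    by (simp add: fps_of_poly_mult mult.assoc flip: fps_of_geometric_poly)
  finally have "Q_series s n = fps_of_poly (geometric_poly ?d * p)"
    by (metis (no_types, lifting) mult_left_cancel fps_of_poly_0 fps_X_neq_one right_minus_eq)
  then have Q: "Q_poly s n = geometric_poly ?d * p"
    unfolding Q_poly_def by (intro the_equality) (auto simp: fps_of_poly_eq_iff)
  have g0: "coeff (geometric_poly ?d) 0 = 1"
    using s_n_pos by (simp add: coeff_geometric_poly)
  then have Q0: "coeff (Q_poly s n) 0 \<noteq> 0" by (simp add: Q p0 coeff_mult_0)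
  \<comment> \<open>With a nonzero constant term, reversing the list creates no trailing zeros, so
    \<open>rev\<close> agrees with \<open>reflect_poly\<close>.\<close>
  have "h_star_symmetric s n \<longleftrightarrow> reflect_poly (Q_poly s n) = Q_poly s n"
    using Q0 by (cases "Q_poly s n" rule: pCons_cases)
      (simp add: h_star_symmetric_def h_star_vector_def coeffs_eq_iff coeffs_reflect_poly)
  also have "\<dots> \<longleftrightarrow> geometric_poly ?d * reflect_poly p = geometric_poly ?d * p"
    by (simp add: Q reflect_poly_mult reflect_geometric_poly)
  also have "\<dots> \<longleftrightarrow> reflect_poly p = p"
    using g0 by auto
  also have "\<dots> \<longleftrightarrow> (\<exists>k. ?P' = fps_X ^ k * fps_of_poly p)"
  proof (rule reflect_poly_fixed_iff)
    show "coeff p 0 \<noteq> 0" by (simp add: p0)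
    show "coeff p i = 0" if "n * ?d < i" for i
      using parallelepiped_empty[of i "(\<le>) 0"] that by (simp add: coeff_p)
    show "fps_nth ?P' m = (if m \<le> n * ?d then coeff p (n * ?d - m) else 0)" for m
      using parallelepiped_empty[of m "(<) 0"] parallelepiped_reflect[of m]
      by (simp add: coeff_p level_series_def)
  qed
  also have "\<dots> \<longleftrightarrow> (\<exists>k. ?F' = fps_X ^ k * ?F)"
  proof -
    have "fps_nth ((1 - fps_X ^ ?d) ^ n :: int fps) 0 \<noteq> 0"
      using s_n_pos by (auto simp: fps_power_zeroth power_0_left)
    then have nz: "(1 - fps_X ^ ?d) ^ n \<noteq> (0 :: int fps)" by (metis fps_zero_nth)
    have "?P' = fps_X ^ k * fps_of_poly p \<longleftrightarrow> ?F' = fps_X ^ k * ?F" for k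
    proof -
      have "fps_X ^ k * fps_of_poly p = (1 - fps_X ^ ?d) ^ n * (fps_X ^ k * ?F)"
        unfolding p P by (rule mult.left_commute)
      then show ?thesis unfolding P' using mult_left_cancel[OF nz] by simp
    qed
    then show ?thesis by blast
  qed
  finally show ?thesis .
qed

text \<open>A common shift of heights becomes a translation: adding \<open>c\<close> embeds each
  level of the closed cone in one of the open cone, and equal finite cardinalities make this
  onto.\<close>

lemma h_star_symmetric_iff_translate:
  "h_star_symmetric s n \<longleftrightarrow> (\<exists>c \<in> integer_vectors n. \<forall>x \<in> integer_vectors n.
     x \<in> wedge s n ((<) 0) 0 \<longleftrightarrow> (\<lambda>j. x j - c j) \<in> wedge s n ((\<le>) 0) 0)"
proof -
  let ?W = "wedge s n ((\<le>) 0) 0" and ?W' = "wedge s n ((<) 0) 0"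
  have int: "x \<in> integer_vectors n" if "x \<in> ?W \<or> x \<in> ?W'" for x
    using that by (auto simp: wedge_def)
  have height: "\<exists>k. x n = real k" if "x \<in> ?W'" for x
  proof -
    have "x n \<in> \<int>" using int that by (simp add: integer_vectors_def)
    moreover have "0 \<le> x n" by (rule wedge_nonneg[OF _ that]) simp
    ultimately show ?thesis by (metis Ints_cases of_int_0_le_iff of_nat_nat of_int_of_nat_eq)
  qed
  have fin: "finite (level n ?W m)" "finite (level n ?W' m)" for m
    by (rule finite_level_wedge, simp)+
  have inj: "inj_on (\<lambda>x j. x j + c j) B" for c :: "nat \<Rightarrow> real" and B
    by (rule inj_onI) (auto simp: fun_eq_iff)
  show ?thesis
  proof
    assume "h_star_symmetric s n"
    then obtain k where k: "level_series n ?W' = fps_X ^ k * level_series n ?W"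
      by (auto simp: h_star_symmetric_iff_reciprocal)
    have card: "card (level n ?W' m) = (if m < k then 0 else card (level n ?W (m - k)))" for m
    proof -
      have "int (card (level n ?W' m)) = fps_nth (fps_X ^ k * level_series n ?W) m"
        unfolding k[symmetric] by (simp add: level_series_def)
      then show ?thesis by (simp add: fps_X_power_mult_nth level_series_def split: if_splits)
    qed
    \<comment> \<open>The origin is the only point of the closed cone at height 0, so the open cone
      has a single point at height \<open>k\<close>.\<close>
    have "card (level n ?W' k) = 1" by (simp add: card level_0_closed_wedge)
    then obtain c where "c \<in> level n ?W' k" by (metis card_1_singletonE insertI1)
    then have c: "c \<in> ?W'" "c n = real k" by (auto simp: level_def)
    have add_c: "(\<lambda>j. x j + c j) \<in> ?W'" if "x \<in> ?W" for x
      using that c by (auto simp: wedge_def integer_vectors_add ray_coord_add add_nonneg_pos)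
    have diff_c: "(\<lambda>j. x j - c j) \<in> ?W" if x: "x \<in> ?W'" for x
    proof -
      obtain m where m: "x n = real m" using height x by blast
      then have xm: "x \<in> level n ?W' m" using x by (simp add: level_def)
      then have "card (level n ?W' m) \<noteq> 0" using fin by auto
      then have "k \<le> m" using card[of m] by (auto split: if_splits)
      have "(\<lambda>x j. x j + c j) ` level n ?W (m - k) \<subseteq> level n ?W' m"
        using add_c c \<open>k \<le> m\<close> by (auto simp: level_def of_nat_diff)
      moreover have "card ((\<lambda>x j. x j + c j) ` level n ?W (m - k)) = card (level n ?W' m)"
        using \<open>k \<le> m\<close> by (simp add: card_image[OF inj] card[of m])
      ultimately have "(\<lambda>x j. x j + c j) ` level n ?W (m - k) = level n ?W' m"
        using fin by (intro card_subset_eq) auto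
      with xm obtain y where "y \<in> ?W" "x = (\<lambda>j. y j + c j)" by (auto simp: level_def)
      then show ?thesis by simp
    qed
    have "x \<in> ?W'" if "(\<lambda>j. x j - c j) \<in> ?W" for x
      using add_c[OF that] by simp
    with diff_c int c show "\<exists>c \<in> integer_vectors n. \<forall>x \<in> integer_vectors n.
        x \<in> ?W' \<longleftrightarrow> (\<lambda>j. x j - c j) \<in> ?W"
      by blast
  next
    assume "\<exists>c \<in> integer_vectors n. \<forall>x \<in> integer_vectors n.
        x \<in> ?W' \<longleftrightarrow> (\<lambda>j. x j - c j) \<in> ?W"
    then obtain c where c: "c \<in> integer_vectors n"
      and iff: "\<And>x. x \<in> integer_vectors n \<Longrightarrow> x \<in> ?W' \<longleftrightarrow> (\<lambda>j. x j - c j) \<in> ?W" by blast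
    have "(\<lambda>_. 0) \<in> ?W" using level_0_closed_wedge[of 0] by (auto simp: level_def)
    then have "c \<in> ?W'" using iff[OF c] by simp
    then obtain k where k: "c n = real k" using height by blast
    have add_c: "(\<lambda>j. x j + c j) \<in> ?W'" if "x \<in> ?W" for x
      using iff[of "\<lambda>j. x j + c j"] that int c by (simp add: integer_vectors_add)
    have diff_c: "(\<lambda>j. x j - c j) \<in> ?W" if "x \<in> ?W'" for x
      using iff[of x] that int by simp
    have card: "card (level n ?W' m) = (if m < k then 0 else card (level n ?W (m - k)))" for m
    proof (cases "m < k")
      case True
      have "level n ?W' m = {}"
      proof (rule ccontr)
        assume "level n ?W' m \<noteq> {}"
        then obtain x where x: "x \<in> ?W'" "x n = real m" by (auto simp: level_def)
        have "0 \<le> x n - c n" by (rule wedge_nonneg[OF _ diff_c[OF x(1)]]) simp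
        then show False using x k True by simp
      qed
      then show ?thesis using True by simp
    next
      case False
      have "level n ?W' m \<subseteq> (\<lambda>x j. x j + c j) ` level n ?W (m - k)"
      proof
        fix x assume "x \<in> level n ?W' m"
        then have "(\<lambda>j. x j - c j) \<in> level n ?W (m - k)"
          using False k diff_c by (auto simp: level_def of_nat_diff)
        then show "x \<in> (\<lambda>x j. x j + c j) ` level n ?W (m - k)" by (rule rev_image_eqI) simp
      qed
      moreover have "(\<lambda>x j. x j + c j) ` level n ?W (m - k) \<subseteq> level n ?W' m"
        using False k add_c by (auto simp: level_def of_nat_diff)
      ultimately have "level n ?W' m = (\<lambda>x j. x j + c j) ` level n ?W (m - k)" by blast
      then show ?thesis using False by (simp add: card_image[OF inj])
    qed
    have "level_series n ?W' = fps_X ^ k * level_series n ?W"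
      by (intro fps_ext) (simp add: fps_X_power_mult_nth level_series_def card)
    then show "h_star_symmetric s n" using h_star_symmetric_iff_reciprocal by blast
  qed
qed

section \<open>Lattice distance from the facets\<close>

lemma ray_coord_cross:
  assumes "2 \<le> j" "j \<le> n"
  shows "of_int (s j * s (j - 1)) * ray_coord s x j = of_int (s (j - 1)) * x j - of_int (s j) * x (j - 1)"
    and "0 < real_of_int (s j * s (j - 1))"
proof -
  have "0 < s j" "0 < s (j - 1)" using s_pos[of j] s_pos[of "j - 1"] assms by auto
  then show "of_int (s j * s (j - 1)) * ray_coord s x j =
      of_int (s (j - 1)) * x j - of_int (s j) * x (j - 1)" "0 < real_of_int (s j * s (j - 1))"
    by (simp_all add: ray_coord_def field_simps)
qed

text \<open>As \<open>c\<close> is interior, its cross term at \<open>j\<close> is positive, and it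
  is a multiple of the gcd. A test point of the open cone attaining the gcd at \<open>j\<close>
  gives the upper bound, since subtracting \<open>c\<close> must leave it in the closed
  cone.\<close>

lemma h_star_symmetricD:
  assumes "h_star_symmetric s n"
  obtains c :: "nat \<Rightarrow> int" where
    "\<And>j. 2 \<le> j \<Longrightarrow> j \<le> n \<Longrightarrow> s (j - 1) * c j - s j * c (j - 1) = gcd (s j) (s (j - 1))"
proof -
  let ?W = "wedge s n ((\<le>) 0) 0" and ?W' = "wedge s n ((<) 0) 0"
  obtain r where r: "r \<in> integer_vectors n"
    and iff: "\<And>x. x \<in> integer_vectors n \<Longrightarrow> x \<in> ?W' \<longleftrightarrow> (\<lambda>j. x j - r j) \<in> ?W"
    using assms by (auto simp: h_star_symmetric_iff_translate)
  define c where "c i = \<lfloor>r i\<rfloor>" for i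
  have rc: "r i = of_int (c i)" for i
    using r by (simp add: c_def integer_vectors_def)
  have "(\<lambda>_. 0) \<in> ?W" using level_0_closed_wedge[of 0] by (auto simp: level_def)
  then have rW: "r \<in> ?W'" using iff[OF r] by simp
  have "s (j - 1) * c j - s j * c (j - 1) = gcd (s j) (s (j - 1))" if j: "2 \<le> j" "j \<le> n" for j
  proof -
    let ?g = "gcd (s j) (s (j - 1))"
    let ?S = "s j * s (j - 1)"
    have g_pos: "0 < ?g" using s_pos[of j] j by simp
    \<comment> \<open>Bezout coefficients give a vector with the right value at \<open>j\<close>,
      but possibly outside the cone.\<close>
    obtain u v where uv: "u * s j + v * s (j - 1) = ?g" using bezout_int by blast
    define e where "e = (\<lambda>i. if i = j then of_int v else if i = j - 1 then - of_int u else (0::real))"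
    have e: "e \<in> integer_vectors n" using j by (auto simp: integer_vectors_def e_def)
    have ej: "of_int ?S * ray_coord s e j = of_int ?g"
      unfolding ray_coord_cross(1)[OF j] uv[symmetric] using j by (auto simp: e_def)
    \<comment> \<open>The sum of all rays except ray \<open>j\<close>: a large multiple moves
      \<open>e\<close> into the open cone without changing ray coordinate \<open>j\<close>.\<close>
    define w where "w = (\<lambda>i. if i \<le> n then (if i < j then real i else real i - 1) * of_int (s i) else 0)"
    have w: "w \<in> integer_vectors n" by (auto simp: integer_vectors_def w_def s_0 Suc_le_eq)
    have wc: "ray_coord s w i = (if i = j then 0 else 1)" if "i \<in> {1..n}" for i
    proof -
      have si: "s i \<noteq> 0" using s_pos[of i] that by auto
      show ?thesis
      proof (cases "i = 1")
        case True
        then show ?thesis using si j by (simp add: ray_coord_def w_def s_0)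
      next
        case False
        then have "s (i - 1) \<noteq> 0" using s_pos[of "i - 1"] that by force
        with si show ?thesis using that j False
          by (cases i j rule: linorder_cases) (auto simp: ray_coord_def w_def of_nat_diff)
      qed
    qed
    obtain N :: nat where "(\<Sum>i\<in>{1..n}. \<bar>ray_coord s e i\<bar>) < real N"
      using reals_Archimedean2 by blast
    moreover have "\<bar>ray_coord s e i\<bar> \<le> (\<Sum>i\<in>{1..n}. \<bar>ray_coord s e i\<bar>)" if "i \<in> {1..n}" for i
      using that by (intro member_le_sum) auto
    ultimately have N: "\<bar>ray_coord s e i\<bar> < real N" if "i \<in> {1..n}" for i
      using that by fastforce
    define y where "y = (\<lambda>i. e i + real N * w i)"
    have y: "y \<in> integer_vectors n"
      using e w by (auto simp: y_def integer_vectors_def)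
    have yc: "ray_coord s y i = ray_coord s e i + (if i = j then 0 else real N)" if "i \<in> {1..n}" for i
      using that by (simp add: y_def ray_coord_add ray_coord_mult wc)
    have "0 < of_int ?S * ray_coord s e j" using ej g_pos by simp
    then have "0 < ray_coord s e j"
      using ray_coord_cross(2)[OF j] by (rule zero_less_mult_pos)
    then have "0 < ray_coord s y i" if "i \<in> {1..n}" for i
      using yc[OF that] N[OF that] by (auto split: if_splits)
    then have "y \<in> ?W'" using y by (simp add: wedge_def)
    then have "(\<lambda>i. y i - r i) \<in> ?W" using iff[OF y] by simp
    then have "0 \<le> ray_coord s (\<lambda>i. y i - r i) j" using j by (simp add: wedge_def)
    then have "ray_coord s r j \<le> ray_coord s e j"
      using j yc[of j] by (simp add: ray_coord_diff)
    then have "of_int ?S * ray_coord s r j \<le> of_int ?S * ray_coord s e j"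
      by (rule mult_left_mono[OF _ less_imp_le[OF ray_coord_cross(2)[OF j]]])
    then have "real_of_int (s (j - 1) * c j - s j * c (j - 1)) \<le> of_int ?g"
      unfolding ray_coord_cross(1)[OF j, of r] ej by (simp add: rc)
    then have "s (j - 1) * c j - s j * c (j - 1) \<le> ?g"
      by (simp only: of_int_le_iff)
    moreover have "?g \<le> s (j - 1) * c j - s j * c (j - 1)"
    proof (rule zdvd_imp_le)
      show "?g dvd s (j - 1) * c j - s j * c (j - 1)" by simp
      have "0 < ray_coord s r j" using rW j by (simp add: wedge_def)
      then have "0 < of_int ?S * ray_coord s r j" using ray_coord_cross(2)[OF j]
        by (intro mult_pos_pos)
      then have "0 < real_of_int (s (j - 1) * c j - s j * c (j - 1))"
        unfolding ray_coord_cross(1)[OF j, of r] by (simp add: rc)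
      then show "0 < s (j - 1) * c j - s j * c (j - 1)"
        by (simp only: of_int_0_less_iff)
    qed
    ultimately show ?thesis by simp
  qed
  then show thesis using that by blast
qed

text \<open>Subtracting \<open>c\<close> lowers each integer cross term by exactly 1, and an integer
  is positive iff it is at least 1. At \<open>i = 1\<close>, \<open>s 1 = c 1 = 1\<close> gives the
  same for \<open>x 1\<close>.\<close>

lemma h_star_symmetricI:
  fixes c :: "nat \<Rightarrow> int"
  assumes "s 1 = 1" "c 1 = 1"
    and c: "\<And>j. 2 \<le> j \<Longrightarrow> j \<le> n \<Longrightarrow> s (j - 1) * c j - s j * c (j - 1) = 1"
  shows "h_star_symmetric s n"
proof -
  define r where "r i = (if i \<in> {1..n} then real_of_int (c i) else 0)" for i
  have r: "r \<in> integer_vectors n" by (auto simp: integer_vectors_def r_def)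
  have "0 < ray_coord s x i \<longleftrightarrow> 0 \<le> ray_coord s (\<lambda>j. x j - r j) i"
    if x: "x \<in> integer_vectors n" and i: "i \<in> {1..n}" for x i
  proof -
    define z where "z i = \<lfloor>x i\<rfloor>" for i
    have xz: "x i = of_int (z i)" for i
      using x by (simp add: z_def integer_vectors_def)
    show ?thesis
    proof (cases "i = 1")
      case True
      then show ?thesis
        using assms n_pos by (auto simp: ray_coord_def s_0 xz r_def)
    next
      case False
      then have i: "2 \<le> i" "i \<le> n" using i by auto
      let ?S = "real_of_int (s i * s (i - 1))"
      let ?f = "s (i - 1) * z i - s i * z (i - 1)"
      have S: "0 < ?S" using ray_coord_cross(2)[OF i] .
      have fx: "?S * ray_coord s x i = of_int ?f"
        unfolding ray_coord_cross(1)[OF i] by (simp add: xz)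
      have "i - 1 \<in> {1..n}" using i by auto
      then have "?S * ray_coord s r i = of_int (s (i - 1) * c i - s i * c (i - 1))"
        unfolding ray_coord_cross(1)[OF i] using i by (simp add: r_def)
      then have fr: "?S * ray_coord s r i = 1" by (simp only: c[OF i] of_int_1)
      have "0 < ray_coord s x i \<longleftrightarrow> 0 < ?S * ray_coord s x i"
        using S by (metis mult_pos_pos zero_less_mult_pos)
      also have "\<dots> \<longleftrightarrow> 0 < ?f" by (simp only: fx of_int_0_less_iff)
      also have "\<dots> \<longleftrightarrow> (1::int) \<le> ?f" by linarith
      also have "\<dots> \<longleftrightarrow> 0 \<le> ?S * ray_coord s (\<lambda>j. x j - r j) i"
        by (simp only: ray_coord_diff right_diff_distrib fx fr diff_ge_0_iff_ge of_int_1_le_iff)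
      also have "\<dots> \<longleftrightarrow> 0 \<le> ray_coord s (\<lambda>j. x j - r j) i"
        using S by (metis less_imp_le mult_nonneg_nonneg mult_pos_neg not_le)
      finally show ?thesis .
    qed
  qed
  then have "x \<in> wedge s n ((<) 0) 0 \<longleftrightarrow> (\<lambda>j. x j - r j) \<in> wedge s n ((\<le>) 0) 0"
    if "x \<in> integer_vectors n" for x
    using that r by (auto simp: wedge_def integer_vectors_diff)
  then show ?thesis
    using r by (auto simp: h_star_symmetric_iff_translate)
qed

end

lemma h_star_symmetric_0:
  assumes "s 0 = 0"
  shows "h_star_symmetric s 0"
proof -
  have "Q_series s 0 = 0" using assms by (simp add: Q_series_def)
  then have "Q_poly s 0 = 0"
    unfolding Q_poly_def by (intro the_equality) auto
  then show ?thesis by (simp add: h_star_symmetric_def h_star_vector_def)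
qed

section \<open>Second-order recurrences\<close>

locale lucas_sequence =
  fixes l b :: int and s :: "nat \<Rightarrow> int"
  assumes l_pos: "0 < l" and b_nz: "b \<noteq> 0" and disc: "0 \<le> l ^ 2 + 4 * b"
    and s_0: "s 0 = 0" and s_1: "s (Suc 0) = 1"
    and s_rec: "\<And>n. s (Suc (Suc n)) = l * s (Suc n) + b * s n"
begin

section \<open>Positivity and growth\<close>

lemma pos_of_b_pos: "0 < b \<Longrightarrow> 0 \<le> s n \<and> 0 < s (Suc n)"
  by (induction n) (auto simp: s_0 s_1 s_rec l_pos add_pos_nonneg)

text \<open>For \<open>b < 0\<close>, this is the best bound valid down to discriminant \<open>0\<close>, where it is an equality.\<close>

lemma ratio_of_b_neg:
  assumes "b < 0"
  shows "0 < s (Suc n) \<and> int (n + 2) * l * s (Suc n) \<le> 2 * int (n + 1) * s (Suc (Suc n))"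
proof (induction n)
  case 0
  then show ?case by (simp add: s_0 s_1 s_rec)
next
  case (Suc n)
  have "0 < int (n + 2) * l * s (Suc n)" using Suc l_pos by simp
  also have "\<dots> \<le> 2 * int (n + 1) * s (Suc (Suc n))" using Suc by simp
  finally have pos: "0 < s (Suc (Suc n))" by (simp add: zero_less_mult_iff)
  have "4 * (- b) * (int (n + 2) * s (Suc n)) \<le> l ^ 2 * (int (n + 2) * s (Suc n))"
    using disc Suc by (intro mult_right_mono) auto
  also have "\<dots> = l * (int (n + 2) * l * s (Suc n))" by (simp add: power2_eq_square)
  also have "\<dots> \<le> l * (2 * int (n + 1) * s (Suc (Suc n)))"
    using Suc l_pos by (intro mult_left_mono) auto
  finally have "2 * (2 * (- b) * int (n + 2) * s (Suc n)) \<le> 2 * (l * int (n + 1) * s (Suc (Suc n)))"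
    by (simp add: algebra_simps)
  then have "int (n + 3) * l * s (Suc (Suc n)) \<le> 2 * int (n + 2) * s (Suc (Suc (Suc n)))"
    by (simp add: s_rec[of "Suc n"] algebra_simps)
  then show ?case using pos by (simp add: algebra_simps)
qed

lemma s_pos: "0 < s (Suc n)"
  using pos_of_b_pos[of n] ratio_of_b_neg[of n] b_nz by fastforce

text \<open>Two steps of the recurrence multiply the term by at least \<open>b + 1\<close>, because
  the sequence does not decrease in between. The square thus gains \<open>b + 1\<close> per step on
  average, a larger base than in \<open>G_square_le\<close>.\<close>

lemma growth_of_b_pos:
  assumes "0 < b"
  shows "(b + 1) ^ n \<le> s (Suc (Suc n)) ^ 2"
proof (induction n rule: induct_nat_012)
  case 0
  show ?case using l_pos by (simp add: s_rec s_1 s_0)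
next
  case 1
  have "l * l + b \<ge> 1 + b" using mult_mono[of 1 l 1 l] l_pos by simp
  then have "(b + 1) \<le> s (Suc (Suc (Suc 0)))" by (simp add: s_rec s_1 s_0)
  moreover have "b + 1 \<le> (b + 1) ^ 2" using assms by (simp add: power2_eq_square)
  moreover have "(b + 1) ^ 2 \<le> s (Suc (Suc (Suc 0))) ^ 2"
    using assms calculation(1) by (intro power_mono) auto
  ultimately show ?case by simp
next
  case (ge2 n)
  let ?n = "Suc (Suc n)"
  have "s ?n \<le> s (Suc ?n)"
  proof -
    have "1 * s ?n \<le> l * s ?n" using l_pos s_pos[of "Suc n"] by (intro mult_right_mono) auto
    moreover have "0 \<le> b * s (Suc n)" using assms s_pos[of n] by simp
    ultimately show ?thesis by (simp add: s_rec[of "Suc n"])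
  qed
  also have "s (Suc ?n) \<le> l * s (Suc ?n)" using l_pos s_pos[of ?n] by simp
  finally have "(b + 1) * s ?n \<le> s (Suc (Suc ?n))"
    by (simp add: s_rec[of ?n] algebra_simps)
  then have "((b + 1) * s ?n) ^ 2 \<le> s (Suc (Suc ?n)) ^ 2"
    using assms s_pos[of "Suc n"] by (intro power_mono) auto
  moreover have "(b + 1) ^ 2 * (b + 1) ^ n \<le> (b + 1) ^ 2 * s ?n ^ 2"
    using ge2 by (intro mult_left_mono) auto
  ultimately show ?case
    by (simp add: power_mult_distrib power2_eq_square mult_ac)
qed

text \<open>The bound of \<open>ratio_of_b_neg\<close> is squared and combined with
  \<open>4 * (- b) \<le> l ^ 2\<close>. The exponential part only matches that of
  \<open>G_square_le\<close>; the factor \<open>int (n + 1) ^ 2\<close> provides the margin.\<close>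

lemma growth_of_b_neg:
  assumes "b < 0"
  shows "int (n + 1) ^ 2 * (- b) ^ n \<le> s (Suc n) ^ 2"
proof (induction n)
  case 0
  then show ?case by (simp add: s_1)
next
  case (Suc n)
  have "(4 * int (n + 1) ^ 2) * (int (n + 2) ^ 2 * (- b) ^ Suc n) =
      (4 * (- b)) * int (n + 2) ^ 2 * (int (n + 1) ^ 2 * (- b) ^ n)" by simp
  also have "\<dots> \<le> l ^ 2 * int (n + 2) ^ 2 * s (Suc n) ^ 2"
    using disc assms Suc by (intro mult_mono) auto
  also have "\<dots> = (int (n + 2) * l * s (Suc n)) ^ 2" by (simp add: power_mult_distrib)
  also have "\<dots> \<le> (2 * int (n + 1) * s (Suc (Suc n))) ^ 2"
    using ratio_of_b_neg[OF assms, of n] l_pos by (intro power_mono) auto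
  also have "\<dots> = (4 * int (n + 1) ^ 2) * s (Suc (Suc n)) ^ 2"
    unfolding power_mult_distrib by simp
  finally have "int (n + 2) ^ 2 * (- b) ^ Suc n \<le> s (Suc (Suc n)) ^ 2"
    by (rule mult_left_le_imp_le) simp
  then show ?case by simp
qed

section \<open>Cassini's identity and gcds of consecutive terms\<close>

lemma cassini: "s (Suc n) ^ 2 - s (Suc (Suc n)) * s n = (- b) ^ n"
proof (induction n)
  case 0
  then show ?case by (simp add: s_0 s_1)
next
  case (Suc n)
  have "s (Suc (Suc n)) ^ 2 - s (Suc (Suc (Suc n))) * s (Suc n) =
      - b * (s (Suc n) ^ 2 - s (Suc (Suc n)) * s n)"
    unfolding s_rec by (simp add: algebra_simps power2_eq_square)
  then show ?case using Suc by simp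
qed

text \<open>Shifted by two: \<open>G m\<close> is the number \<open>g\<^bsub>m+2\<^esub>\<close> of the introduction.\<close>

definition G :: "nat \<Rightarrow> int" where
  "G m = gcd (s (m + 2)) (s (m + 1))"

lemma G_pos: "0 < G m"
  using s_pos[of m] by (simp add: G_def)

lemma G_le: "G m \<le> G (Suc m)"
proof -
  have "G m dvd G (Suc m)" by (simp add: G_def s_rec[of "Suc m"])
  then show ?thesis using G_pos by (simp add: zdvd_imp_le)
qed

lemma G_Suc_le: "G (Suc m) \<le> \<bar>b\<bar> * G m"
proof -
  let ?h = "G (Suc m)"
  have h: "?h dvd s (m + 3)" "?h dvd s (m + 2)" by (simp_all add: G_def numeral_eq_Suc)
  moreover have "b * s (m + 1) = s (m + 3) - l * s (m + 2)"
    by (simp add: s_rec numeral_eq_Suc)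
  ultimately have "?h dvd b * s (m + 1)" "?h dvd b * s (m + 2)" by simp_all
  then have "?h dvd gcd (b * s (m + 2)) (b * s (m + 1))" by simp
  then have "?h dvd \<bar>b\<bar> * G m" by (simp add: gcd_mult_left G_def abs_mult)
  then show ?thesis using G_pos[of m] b_nz by (simp add: zdvd_imp_le)
qed

text \<open>The product \<open>G m * G (Suc m)\<close> divides both products in
  \<open>cassini\<close> at index \<open>m + 1\<close>, hence the power of \<open>b\<close> there;
  by \<open>G_le\<close> it bounds the square.\<close>

lemma G_square_le: "G m ^ 2 \<le> \<bar>b\<bar> ^ (m + 1)"
proof -
  have "G m * G (Suc m) dvd s (m + 2) * s (m + 2)"
    by (intro mult_dvd_mono) (simp_all add: G_def)
  moreover have "G m * G (Suc m) dvd s (m + 1) * s (m + 3)"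
    by (intro mult_dvd_mono) (simp_all add: G_def numeral_eq_Suc)
  ultimately have "G m * G (Suc m) dvd (- b) ^ (m + 1)"
    unfolding cassini[symmetric] by (simp add: power2_eq_square mult.commute numeral_eq_Suc)
  then have "G m * G (Suc m) dvd \<bar>(- b) ^ (m + 1)\<bar>" by (simp only: dvd_abs_iff)
  then have "G m * G (Suc m) \<le> \<bar>b\<bar> ^ (m + 1)"
    using b_nz by (intro zdvd_imp_le) (simp_all add: power_abs abs_mult)
  moreover have "G m ^ 2 \<le> G m * G (Suc m)"
    using G_le[of m] G_pos[of m] by (simp add: power2_eq_square)
  ultimately show ?thesis by simp
qed

section \<open>Which recurrences give symmetry\<close>

lemma lecture_hall: "1 \<le> n \<Longrightarrow> lecture_hall s n"
proof
  show "0 < s i" if "1 \<le> i" for i using s_pos[of "i - 1"] that by simp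
qed (use s_0 in auto)

text \<open>To the equation at facet \<open>m + 3\<close>, \<open>b\<close> times that at facet
  \<open>m + 2\<close> is added. By the recurrence the products of \<open>s (m + 1)\<close> and
  \<open>c (m + 2)\<close> cancel, and all remaining terms contain \<open>s (m + 2)\<close>.\<close>

lemma h_star_symmetric_dvd:
  assumes "h_star_symmetric s n" "m + 3 \<le> n"
  shows "s (m + 2) dvd G (Suc m) + b * G m"
proof -
  interpret lecture_hall s n using assms by (intro lecture_hall) simp
  obtain c where c: "\<And>j. 2 \<le> j \<Longrightarrow> j \<le> n \<Longrightarrow>
      s (j - 1) * c j - s j * c (j - 1) = gcd (s j) (s (j - 1))"
    using h_star_symmetricD assms(1) by blast
  have G: "G (Suc m) = s (m + 2) * c (m + 3) - s (m + 3) * c (m + 2)"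
    "G m = s (m + 1) * c (m + 2) - s (m + 2) * c (m + 1)"
    using c[of "m + 3"] c[of "m + 2"] assms(2) by (simp_all add: G_def numeral_eq_Suc)
  have rec: "s (m + 3) = l * s (m + 2) + b * s (m + 1)"
    by (simp add: numeral_eq_Suc s_rec)
  have "G (Suc m) + b * G m = s (m + 2) * (c (m + 3) - l * c (m + 2) - b * c (m + 1))"
    unfolding G rec by (simp add: algebra_simps)
  then show ?thesis by simp
qed

text \<open>The sum in \<open>h_star_symmetric_dvd\<close> is positive here, so it bounds
  \<open>s (m + 2)\<close>, which is then at most \<open>2 * b * G m\<close>. One suitable
  \<open>m\<close> excludes all \<open>n \<ge> m + 3\<close> at once.\<close>

lemma not_symmetric_of_b_pos:
  assumes "0 < b"
  shows "\<exists>n\<^sub>0. \<forall>n \<ge> n\<^sub>0. \<not> h_star_symmetric s n"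
proof -
  have "1 < (real_of_int b + 1) / real_of_int b" using assms by simp
  \<comment> \<open>The constant anticipates the squared bound: \<open>4 * b ^ 2\<close> from
    \<open>2 * b\<close>, and one more \<open>b\<close> from the exponent \<open>m + 1\<close> in
    \<open>G_square_le\<close>.\<close>
  then obtain m where "real_of_int (4 * b ^ 3) < ((real_of_int b + 1) / real_of_int b) ^ m"
    using real_arch_pow by blast
  then have "real_of_int (4 * b ^ 3 * b ^ m) < real_of_int ((b + 1) ^ m)"
    using assms by (simp add: power_divide less_divide_eq)
  then have m: "4 * b ^ 3 * b ^ m < (b + 1) ^ m" by (simp only: of_int_less_iff)
  have "\<not> h_star_symmetric s n" if "m + 3 \<le> n" for n
  proof
    assume "h_star_symmetric s n"
    then have "s (m + 2) dvd G (Suc m) + b * G m" using that by (rule h_star_symmetric_dvd)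
    then have "s (m + 2) \<le> G (Suc m) + b * G m"
      using G_pos assms by (intro zdvd_imp_le) (auto intro: add_pos_pos)
    also have "\<dots> \<le> 2 * b * G m" using G_Suc_le[of m] assms by simp
    finally have "s (m + 2) ^ 2 \<le> (2 * b * G m) ^ 2"
      using s_pos[of "m + 1"] by (intro power_mono) auto
    also have "\<dots> = 4 * b ^ 2 * G m ^ 2" by (simp add: power_mult_distrib)
    also have "\<dots> \<le> 4 * b ^ 2 * b ^ (m + 1)"
      using G_square_le[of m] assms by (intro mult_left_mono) auto
    also have "\<dots> = 4 * b ^ 3 * b ^ m" by (simp add: numeral_eq_Suc)
    also have "\<dots> < s (m + 2) ^ 2" using m growth_of_b_pos[OF assms, of m] by simp
    finally show False by simp
  qed
  then show ?thesis by blast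
qed

text \<open>From \<open>m = M\<close> on, the sum in \<open>h_star_symmetric_dvd\<close> is smaller
  in absolute value than \<open>s (m + 2)\<close> and so vanishes; hence \<open>G\<close> grows by
  the factor \<open>- b\<close>. After \<open>M + 2\<close> such steps it exceeds the bound of
  \<open>G_square_le\<close>.\<close>

lemma not_symmetric_of_b_less:
  assumes "b < -1"
  shows "\<exists>n\<^sub>0. \<forall>n \<ge> n\<^sub>0. \<not> h_star_symmetric s n"
proof -
  define M where "M = nat (- b)"
  have "\<not> h_star_symmetric s n" if n: "2 * M + 5 \<le> n" for n
  proof
    assume sym: "h_star_symmetric s n"
    have step: "G (Suc m) = (- b) * G m" if m: "M \<le> m" "m + 3 \<le> n" for m
    proof -
      have dvd: "s (m + 2) dvd G (Suc m) + b * G m" using sym m(2) by (rule h_star_symmetric_dvd)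
      have "(int (m + 2) * G m) ^ 2 \<le> int (m + 2) ^ 2 * (- b) ^ (m + 1)"
        using G_square_le[of m] assms unfolding power_mult_distrib by (intro mult_left_mono) auto
      also have "\<dots> \<le> s (m + 2) ^ 2" using growth_of_b_neg[of "m + 1"] assms by simp
      finally have "int (m + 2) * G m \<le> s (m + 2)"
        using s_pos[of "m + 1"] by (intro power2_le_imp_le[of "int (m + 2) * G m"]) auto
      moreover have "(- b) * G m \<le> int (m + 2) * G m"
        using m(1) G_pos[of m] unfolding M_def by (intro mult_right_mono) auto
      \<comment> \<open>By \<open>G_Suc_le\<close> the sum is nonpositive, and
        \<open>G (Suc m) > 0\<close> makes its absolute value less than
        \<open>(- b) * G m\<close>.\<close>
      ultimately have "\<bar>G (Suc m) + b * G m\<bar> < \<bar>s (m + 2)\<bar>"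
        using G_Suc_le[of m] G_pos[of "Suc m"] assms by simp
      then have "G (Suc m) + b * G m = 0"
        using dvd dvd_imp_le_int by (metis not_le)
      then show ?thesis by simp
    qed
    have "G (M + k) = (- b) ^ k * G M" if "k \<le> M + 2" for k
      using that
    proof (induction k)
      case 0
      then show ?case by simp
    next
      case (Suc k)
      then show ?case using step[of "M + k"] n by simp
    qed
    then have "G (M + (M + 2)) = (- b) ^ (M + 2) * G M" by blast
    moreover have "(- b) ^ (M + 2) * 1 \<le> (- b) ^ (M + 2) * G M"
      using G_pos[of M] assms by (intro mult_left_mono zero_le_power) auto
    ultimately have "((- b) ^ (M + 2)) ^ 2 \<le> G (M + (M + 2)) ^ 2"
      using assms by (intro power_mono zero_le_power) auto
    also have "\<dots> \<le> (- b) ^ (M + (M + 2) + 1)"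
      using G_square_le[of "M + (M + 2)"] assms by simp
    \<comment> \<open>With \<open>M + 2\<close> steps the left exponent \<open>2 * M + 4\<close>
      just exceeds the right one, \<open>2 * M + 3\<close>.\<close>
    finally have "(- b) ^ ((M + 2) * 2) \<le> (- b) ^ (M + (M + 2) + 1)"
      by (simp only: power_mult)
    then have "(M + 2) * 2 \<le> M + (M + 2) + 1"
      using assms by (subst (asm) power_increasing_iff) auto
    then show False by simp
  qed
  then show ?thesis by blast
qed

text \<open>With \<open>c j = s j + s (j - 1)\<close> the cross term is
  \<open>s (j - 1) ^ 2 - s j * s (j - 2)\<close>, which \<open>cassini\<close> evaluates to
  \<open>(- b) ^ (j - 2) = 1\<close>.\<close>

lemma symmetric_of_b_eq:
  assumes "b = -1"
  shows "h_star_symmetric s n"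
proof (cases "n = 0")
  case True
  then show ?thesis using h_star_symmetric_0 s_0 by simp
next
  case False
  then interpret lecture_hall s n by (intro lecture_hall) simp
  show ?thesis
  proof (rule h_star_symmetricI[where c = "\<lambda>j. s j + s (j - 1)"])
    fix j :: nat assume "2 \<le> j"
    then obtain i where "j = Suc (Suc i)" by (metis add_2_eq_Suc le_Suc_ex)
    then show "s (j - 1) * (s j + s (j - 1)) - s j * (s (j - 1) + s (j - 1 - 1)) = 1"
      using cassini[of i] assms by (simp add: algebra_simps power2_eq_square)
  qed (simp_all add: s_0 s_1)
qed

end

theorem theorem4p4:
  fixes l b :: int and s :: "nat \<Rightarrow> int"
  assumes "l > 0" and "b \<noteq> 0" and "l ^ 2 + 4 * b \<ge> 0"
    and "s 0 = 0" and "s 1 = 1"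
    and "\<And>n. n \<ge> 2 \<Longrightarrow> s n = l * s (n - 1) + b * s (n - 2)"
  shows "((\<forall>n. h_star_symmetric s n) \<longleftrightarrow> b = -1) \<and>
    (b \<noteq> -1 \<longrightarrow> (\<exists>n\<^sub>0. \<forall>n \<ge> n\<^sub>0. \<not> h_star_symmetric s n))"
proof -
  interpret lucas_sequence l b s
  proof
    show "s (Suc (Suc n)) = l * s (Suc n) + b * s n" for n
      using assms(6)[of "Suc (Suc n)"] by simp
  qed (use assms in simp_all)
  have "\<exists>n\<^sub>0. \<forall>n \<ge> n\<^sub>0. \<not> h_star_symmetric s n" if "b \<noteq> -1"
  proof (cases "0 < b")
    case False
    then have "b < -1" using that b_nz by linarith
    then show ?thesis by (rule not_symmetric_of_b_less)
  qed (rule not_symmetric_of_b_pos)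
  then show ?thesis
    using symmetric_of_b_eq by blast
qed

end
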